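(* Let $G$ be an interval colorable graph, and let $H$ be a graph with $|V(H)|=n$ that has an interval coloring $\alpha_H$ such that $L=USE(V(H),\alpha_H)$ is continuous. Then the composition $G[H]$ is interval colorable, and moreover $$w(G[H])\le w(G)\cdot n+\overline L\quad\text{and}\quad W(G[H])\ge W(G)\cdot n+\overline L,$$ where $\overline L$ is the largest element of $L$.
   Context: All graphs are finite, undirected, without loops or multiple edges. A proper edge-coloring of $G$ with consecutive integers $c_1,\ldots,c_t$ is an interval $t$-coloring if all $t$ colors are used and for every vertex $v$ the spectrum $S(v,\alpha)$ (set of colors on edges incident to $v$) is an interval of integers. $G$ is interval colorable if it has an interval $t$-coloring for some positive integer $t$; for such $G$, $w(G)$ and $W(G)$ denote the smallest and largest $t$ for which $G$ has an interval $t$-coloring. $\overline S(v,\alpha)=\max S(v,\alpha)$. For $V'\subseteq V(G)$, $USE(V',\alpha)$ is the sequence of the numbers $\overline S(v,\alpha)$, $v\in V'$ (with multiplicity), arranged in nondecreasing order. A nondecreasing sequence of nonnegative integers is continuous if it contains every integer between its smallest and largest element. The composition (lexicographic product) $G[H]$ has vertex set $V(G)\times V(H)$, with $(u_1,v_1)(u_2,v_2)$ an edge iff $u_1u_2\in E(G)$, or $u_1=u_2$ and $v_1v_2\in E(H)$.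
   Formalization: The interval coloring of H is additionally required to have smallest color 1; with arbitrary consecutive integers the bounds fail, e.g. G = H = K_2 with the edge of H colored 0 would give w(K_4) ≤ 2, and colored 3 would give W(K_4) ≥ 5. *)

theory Defs
  imports "HOL-Library.Multiset"
begin

text \<open>A graph is a pair of a vertex set and a set of two-element vertex sets.\<close>

type_synonym 'a ugraph = "'a set \<times> 'a set set"

abbreviation verts :: "'a ugraph \<Rightarrow> 'a set" where
  "verts G \<equiv> fst G"

abbreviation edges :: "'a ugraph \<Rightarrow> 'a set set" where
  "edges G \<equiv> snd G"

definition simple_graph :: "'a ugraph \<Rightarrow> bool" where
  "simple_graph G \<longleftrightarrow> finite (verts G) \<and> (\<forall>e\<in>edges G. e \<subseteq> verts G \<and> card e = 2)"

definition proper_coloring :: "'a ugraph \<Rightarrow> ('a set \<Rightarrow> int) \<Rightarrow> bool" where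
  "proper_coloring G \<alpha> \<longleftrightarrow>
     (\<forall>e\<in>edges G. \<forall>f\<in>edges G. e \<noteq> f \<and> e \<inter> f \<noteq> {} \<longrightarrow> \<alpha> e \<noteq> \<alpha> f)"

definition spectrum :: "'a ugraph \<Rightarrow> ('a set \<Rightarrow> int) \<Rightarrow> 'a \<Rightarrow> int set" where
  "spectrum G \<alpha> v = \<alpha> ` {e \<in> edges G. v \<in> e}"

text \<open>The colors are consecutive integers \<open>c, \<dots>, c + t - 1\<close>, all of them used.  The spectrum of an
  isolated vertex is the empty interval (\<open>a > b\<close>).\<close>

definition interval_coloring :: "'a ugraph \<Rightarrow> nat \<Rightarrow> ('a set \<Rightarrow> int) \<Rightarrow> bool" where
  "interval_coloring G t \<alpha> \<longleftrightarrow>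
     proper_coloring G \<alpha> \<and>
     (\<exists>c. \<alpha> ` edges G = {c..<c + int t}) \<and>
     (\<forall>v\<in>verts G. \<exists>a b. spectrum G \<alpha> v = {a..b})"

definition interval_colorable :: "'a ugraph \<Rightarrow> bool" where
  "interval_colorable G \<longleftrightarrow> (\<exists>t>0. \<exists>\<alpha>. interval_coloring G t \<alpha>)"

text \<open>Both values below are meaningful for interval colorable finite graphs only; the maximum then
  exists because an interval \<open>t\<close>-coloring uses \<open>t\<close> colors, whence \<open>t \<le> card (edges G)\<close>.\<close>

definition w :: "'a ugraph \<Rightarrow> nat" where
  "w G = (LEAST t. t > 0 \<and> (\<exists>\<alpha>. interval_coloring G t \<alpha>))"

definition W :: "'a ugraph \<Rightarrow> nat" where
  "W G = (GREATEST t. t > 0 \<and> (\<exists>\<alpha>. interval_coloring G t \<alpha>))"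

text \<open>The largest color at a vertex, with the convention that it is \<open>0\<close> at an isolated vertex
  (\<open>Max {}\<close> is unspecified in HOL).\<close>

definition max_color :: "'a ugraph \<Rightarrow> ('a set \<Rightarrow> int) \<Rightarrow> 'a \<Rightarrow> int" where
  "max_color G \<alpha> v = (if spectrum G \<alpha> v = {} then 0 else Max (spectrum G \<alpha> v))"

definition USE :: "'a ugraph \<Rightarrow> 'a set \<Rightarrow> ('a set \<Rightarrow> int) \<Rightarrow> int list" where
  "USE G V' \<alpha> = sorted_list_of_multiset (image_mset (max_color G \<alpha>) (mset_set V'))"

definition continuous_seq :: "int list \<Rightarrow> bool" where
  "continuous_seq xs \<longleftrightarrow>
     sorted xs \<and> (\<forall>x\<in>set xs. 0 \<le> x) \<and>
     (\<forall>k. Min (set xs) \<le> k \<and> k \<le> Max (set xs) \<longrightarrow> k \<in> set xs)"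

definition composition :: "'a ugraph \<Rightarrow> 'b ugraph \<Rightarrow> ('a \<times> 'b) ugraph" where
  "composition G H =
     (verts G \<times> verts H,
      {{(u1, v1), (u2, v2)} | u1 v1 u2 v2.
         u1 \<in> verts G \<and> u2 \<in> verts G \<and> v1 \<in> verts H \<and> v2 \<in> verts H \<and>
         ({u1, u2} \<in> edges G \<or> u1 = u2 \<and> {v1, v2} \<in> edges H)})"

lemma simple_graph_composition:
  assumes "simple_graph G" and "simple_graph H"
  shows "simple_graph (composition G H)"
proof -
  have G: "u \<noteq> u'" if "{u, u'} \<in> edges G" for u u'
    using assms(1) that unfolding simple_graph_def by force
  have H: "v \<noteq> v'" if "{v, v'} \<in> edges H" for v v'
    using assms(2) that unfolding simple_graph_def by force
  show ?thesis
    using assms G H unfolding simple_graph_def composition_def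
    by (auto simp: card_insert_if)
qed

end

theory Submission
  imports Defs
begin

text \<open>
  Let \<open>f v\<close> be the largest color of \<open>\<alpha>H\<close> at \<open>v\<close>, and let \<open>\<alpha>G\<close> use the colors \<open>0, \<dots>, s - 1\<close>.
  Continuity of \<open>USE\<close> lets one color the edges of \<open>K\<^bsub>n,n\<^esub>\<close> on two copies of \<open>verts H\<close> so that both
  copies of \<open>v\<close> see exactly the colors \<open>f v + 1, \<dots>, f v + n\<close>.  Shifting this coloring by
  \<open>n * \<alpha>G {u, u'}\<close> on the edges above \<open>{u, u'}\<close> makes the edges leaving the copy of \<open>H\<close> at \<open>u\<close>
  occupy consecutive blocks of length \<open>n\<close>.  Shifting \<open>\<alpha>H\<close> by \<open>n * Min (spectrum G \<alpha>G u)\<close> on that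
  copy puts its colors directly below these blocks.  In total the colors \<open>1, \<dots>, s * n + t\<close> appear,
  and \<open>t\<close> is the largest element of \<open>USE\<close> because the smallest color of \<open>\<alpha>H\<close> is \<open>1\<close>.
\<close>

section \<open>Sliding windows and the coloring of the complete bipartite graph\<close>

lemma unit_step_mono:
  fixes l :: "nat \<Rightarrow> int"
  assumes step: "\<And>i. Suc i < n \<Longrightarrow> l (Suc i) = l i \<or> l (Suc i) = l i + 1"
    and "i \<le> j" "j < n"
  shows "l i \<le> l j \<and> l j \<le> l i + int (j - i)"
  using assms(2,3)
proof (induction j rule: dec_induct)
  case (step j)
  then show ?case using assms(1)[of j] by auto
qed simp

text \<open>Sliding the window from \<open>i\<close> to \<open>i + 1\<close> trades \<open>g i\<close> for \<open>g (i + n)\<close>.  If \<open>l\<close> is constant there,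
  \<open>g (i + n) = g i\<close>; if \<open>l\<close> jumps, \<open>g i\<close> has to be the smallest color \<open>l i + 1\<close> and \<open>g (i + n) = g i + n\<close>.
  So only the values of \<open>g\<close> at jumps below \<open>n\<close> are prescribed; the others take the colors above
  \<open>l (n - 1)\<close> in increasing order.\<close>

lemma sliding_window_colors:
  fixes l :: "nat \<Rightarrow> int"
  assumes step: "\<And>i. Suc i < n \<Longrightarrow> l (Suc i) = l i \<or> l (Suc i) = l i + 1"
  obtains g :: "nat \<Rightarrow> int"
  where "\<And>i. i < n \<Longrightarrow> bij_betw (\<lambda>j. g (i + j)) {..<n} {l i + 1..l i + int n}"
proof -
  define jump where "jump i \<longleftrightarrow> Suc i < n \<and> l (Suc i) \<noteq> l i" for i
  \<comment> \<open>The term \<open>int i - l i + l 0\<close> counts the non-jumps below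
    \<open>i\<close>, so successive non-jumps take successive colors from
    \<open>l (n - 1) + 1\<close> on.\<close>
  define g0 where "g0 i = (if jump i then l i + 1 else l (n - 1) + 1 + int i - l i + l 0)" for i
  define g where "g k = (if k < n then g0 k else g0 (k - n) + (if jump (k - n) then int n else 0))" for k
  note mono = unit_step_mono[of n l, OF step]
  \<comment> \<open>Two jumps get different colors because \<open>l\<close> rises right after the
    first one, two non-jumps because their ranks differ. Colors of jumps are at most
    \<open>l (n - 1)\<close>, those of non-jumps exceed it.\<close>
  have inj: "g0 i \<noteq> g0 j" if "i < j" "j < n" for i j
  proof -
    have "l i \<le> l (Suc i)" "l (Suc i) \<le> l j" "l j \<le> l (Suc i) + int (j - Suc i)"
      "l j \<le> l (n - 1)" "l 0 \<le> l i" "l i \<le> l 0 + int i" "l j \<le> l 0 + int j"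
      using mono[of i "Suc i"] mono[of "Suc i" j] mono[of j "n-1"] mono[of 0 i] mono[of 0 j] that
      by auto
    moreover have "jump i \<Longrightarrow> l (Suc i) = l i + 1" "\<not> jump i \<Longrightarrow> l (Suc i) = l i"
      using step[of i] that by (auto simp: jump_def)
    moreover have "jump j \<Longrightarrow> l j + 1 \<le> l (n - 1)"
      using step[of j] mono[of "Suc j" "n-1"] by (auto simp: jump_def)
    ultimately show ?thesis
      using that by (auto simp: g0_def)
  qed
  have "inj_on g0 {..<n}"
    by (rule inj_onI) (metis inj lessThan_iff linorder_less_linear)
  moreover have "g0 ` {..<n} \<subseteq> {l 0 + 1..l 0 + int n}"
  proof clarify
    fix i assume "i < n"
    have *: "l 0 \<le> l i" "l i \<le> l 0 + int i" "l i \<le> l (n - 1)" "l (n - 1) \<le> l i + int (n - 1 - i)"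
      using mono[of 0 i] mono[of i "n-1"] \<open>i < n\<close> by auto
    then show "g0 i \<in> {l 0 + 1..l 0 + int n}"
      using \<open>i < n\<close> by (auto simp: g0_def)
  qed
  ultimately have base: "g0 ` {..<n} = {l 0 + 1..l 0 + int n}"
    by (intro card_subset_eq) (auto simp: card_image)
  have img: "g ` {i..<i + n} = {l i + 1..l i + int n}" if "i < n" for i
    using that
  proof (induction i)
    case 0
    have "g ` {0..<n} = g0 ` {..<n}"
      by (intro image_cong) (auto simp: g_def)
    then show ?case using base by simp
  next
    case (Suc i)
    then have IH: "g ` {i..<i + n} = {l i + 1..l i + int n}" by simp
    have split: "{i..<i + n} = insert i {Suc i..<i + n}" "{Suc i..<Suc i + n} = insert (i + n) {Suc i..<i + n}"
      using Suc.prems by auto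
    have gn: "g (i + n) = g i + (if jump i then int n else 0)"
      using Suc.prems by (simp add: g_def)
    show ?case
    proof (cases "jump i")
      case False
      then have "l (Suc i) = l i" using Suc.prems by (simp add: jump_def)
      then show ?thesis using IH gn False unfolding split by simp
    next
      case True
      have l: "l (Suc i) = l i + 1" using True step[of i] by (auto simp: jump_def)
      have gi: "g i = l i + 1" using True Suc.prems by (simp add: g_def g0_def)
      \<comment> \<open>The \<open>n\<close> indices have \<open>n\<close> colors, hence
        \<open>g\<close> is injective on them, and dropping the index \<open>i\<close> removes
        exactly the smallest color of the window.\<close>
      have "inj_on g {i..<i + n}" using IH by (intro eq_card_imp_inj_on) auto
      then have "g i \<notin> g ` {Suc i..<i + n}"
        using Suc.prems by (subst inj_on_image_mem_iff[of g "{i..<i + n}"]) auto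
      then have "g ` {Suc i..<i + n} = {l i + 1..l i + int n} - {l i + 1}"
        using IH gi unfolding split by (metis Diff_insert_absorb image_insert)
      then have "g ` {Suc i..<Suc i + n} =
          insert (l i + 1 + int n) ({l i + 1..l i + int n} - {l i + 1})"
        using gn gi True unfolding split by simp
      also have "\<dots> = {l (Suc i) + 1..l (Suc i) + int n}"
        using Suc.prems by (simp add: l set_eq_iff) presburger
      finally show ?thesis .
    qed
  qed
  show thesis
  proof (rule that)
    fix i assume "i < n"
    have "(\<lambda>j. g (i + j)) ` {..<n} = g ` ((+) i ` {..<n})" by (simp add: image_image)
    also have "(+) i ` {..<n} = {i..<i + n}"
      by (simp add: lessThan_atLeast0 add.commute)
    finally have eq: "(\<lambda>j. g (i + j)) ` {..<n} = {l i + 1..l i + int n}"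
      using img[OF \<open>i < n\<close>] by simp
    moreover have "inj_on (\<lambda>j. g (i + j)) {..<n}"
      by (rule eq_card_imp_inj_on) (simp_all add: eq)
    ultimately show "bij_betw (\<lambda>j. g (i + j)) {..<n} {l i + 1..l i + int n}"
      by (simp add: bij_betw_def)
  qed
qed

text \<open>Sort \<open>V\<close> by \<open>f\<close>; by \<open>conv\<close>, \<open>f\<close>
  rises by at most 1 from one vertex to the next. The pair at positions \<open>i\<close> and
  \<open>j\<close> gets color \<open>g (i + j)\<close>. This is symmetric, so both copies of a
  vertex see the same colors, and the row of \<open>x\<close> is the window of \<open>g\<close> that
  starts at the position of \<open>x\<close>. A singleton \<open>{x}\<close> stands for the edge
  joining the two copies of \<open>x\<close>.\<close>

lemma complete_bipartite_window_coloring: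
  fixes f :: "'b \<Rightarrow> int"
  assumes fin: "finite V"
    and conv: "\<And>x y. x \<in> V \<Longrightarrow> y \<in> V \<Longrightarrow> {f x..f y} \<subseteq> f ` V"
  obtains K :: "'b set \<Rightarrow> int"
  where "\<And>x. x \<in> V \<Longrightarrow> bij_betw (\<lambda>y. K {x, y}) V {f x + 1..f x + int (card V)}"
proof -
  obtain ys where ys: "set ys = V" "distinct ys"
    using finite_distinct_list[OF fin] by blast
  define xs where "xs = sort_key f ys"
  define n where "n = card V"
  have xs: "set xs = V" "distinct xs" "sorted (map f xs)" "length xs = n"
    using ys by (auto simp: xs_def n_def distinct_card)
  have step: "f (xs ! Suc i) = f (xs ! i) \<or> f (xs ! Suc i) = f (xs ! i) + 1"
    if "Suc i < n" for i
  \<comment> \<open>A larger rise would skip the value \<open>f (xs ! i) + 1\<close>, which is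
    attained at some position \<open>k\<close>; sortedness excludes both \<open>k \<le> i\<close>
    and \<open>k > i\<close>.\<close>
  proof (rule ccontr)
    assume neg: "\<not> ?thesis"
    have mono: "f (xs ! a) \<le> f (xs ! b)" if "a \<le> b" "b < n" for a b
      using sorted_nth_mono[OF xs(3), of a b] that xs(4) by simp
    have gap: "f (xs ! i) + 1 < f (xs ! Suc i)"
      using neg mono[of i "Suc i"] that by auto
    have "{f (xs ! i)..f (xs ! Suc i)} \<subseteq> f ` V"
      using conv that xs by (metis Suc_lessD nth_mem)
    with gap have "f (xs ! i) + 1 \<in> f ` V" by auto
    then obtain k where k: "k < n" "f (xs ! k) = f (xs ! i) + 1"
      using xs by (metis imageE in_set_conv_nth)
    show False
      using mono[of k i] mono[of "Suc i" k] k gap that by (cases "k \<le> i") auto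
  qed
  obtain g where g: "\<And>i. i < n \<Longrightarrow>
      bij_betw (\<lambda>j. g (i + j)) {..<n} {f (xs ! i) + 1..f (xs ! i) + int n}"
    using sliding_window_colors[of n "\<lambda>i. f (xs ! i)", OF step] by blast
  have bij: "bij_betw ((!) xs) {..<n} V"
    using bij_betw_nth[OF xs(2), of "{..<n}" V] xs by simp
  define pos where "pos = the_inv_into {..<n} ((!) xs)"
  have pos: "bij_betw pos V {..<n}"
    unfolding pos_def by (rule bij_betw_the_inv_into[OF bij])
  have nth_pos: "xs ! pos x = x" if "x \<in> V" for x
    unfolding pos_def using that bij by (metis bij_betw_def f_the_inv_into_f)
  \<comment> \<open>\<open>Min + Max\<close> expresses the sum of the positions as a function of the unordered pair\<close>
  define K where "K S = g (Min (pos ` S) + Max (pos ` S))" for S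
  have K: "K {x, y} = g (pos x + pos y)" for x y
    by (cases "pos x \<le> pos y") (auto simp: K_def min_def max_def add.commute)
  show thesis
  proof (rule that)
    fix x assume x: "x \<in> V"
    then have "pos x < n" using pos by (auto simp: bij_betw_def)
    from bij_betw_trans[OF pos g[OF this]]
    show "bij_betw (\<lambda>y. K {x, y}) V {f x + 1..f x + int (card V)}"
      using nth_pos[OF x] by (simp add: K comp_def n_def)
  qed
qed

section \<open>Basic facts on edges, spectra and the extremal values \<open>w\<close> and
  \<open>W\<close>\<close>

lemma finite_edges: "simple_graph G \<Longrightarrow> finite (edges G)"
  unfolding simple_graph_def by (metis Pow_iff finite_Pow_iff finite_subset subsetI)

lemma finite_spectrum: "simple_graph G \<Longrightarrow> finite (spectrum G \<alpha> v)"
  by (simp add: spectrum_def finite_edges)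

lemma edge_eq_doubleton:
  assumes "simple_graph G" "e \<in> edges G" "u \<in> e"
  obtains u' where "e = {u, u'}" "u \<noteq> u'" "u \<in> verts G" "u' \<in> verts G"
proof -
  have "card e = 2" "e \<subseteq> verts G" using assms by (auto simp: simple_graph_def)
  then show thesis using that assms(3) unfolding card_2_iff by auto
qed

lemma proper_coloring_inj:
  assumes "proper_coloring G \<alpha>" "{v, x} \<in> edges G" "{v, y} \<in> edges G" "\<alpha> {v, x} = \<alpha> {v, y}"
  shows "x = y"
proof -
  have "{v, x} \<inter> {v, y} \<noteq> {}" by simp
  then have "{v, x} = {v, y}" using assms unfolding proper_coloring_def by metis
  then show ?thesis by (auto simp: doubleton_eq_iff)
qed

text \<open>Each of the \<open>t\<close> colors needs an edge of its own. This bound ensures that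
  the \<open>GREATEST\<close> in \<open>W\<close> is attained.\<close>

lemma interval_coloring_le_card_edges:
  assumes "simple_graph G" "interval_coloring G t \<alpha>"
  shows "t \<le> card (edges G)"
proof -
  obtain c where "\<alpha> ` edges G = {c..<c + int t}"
    using assms(2) by (auto simp: interval_coloring_def)
  then have "card (\<alpha> ` edges G) = t" by simp
  then show ?thesis using card_image_le[OF finite_edges[OF assms(1)]] by metis
qed

lemma w_le: "t > 0 \<Longrightarrow> interval_coloring G t \<alpha> \<Longrightarrow> w G \<le> t"
  unfolding w_def by (rule Least_le) blast

lemma w_attained:
  assumes "interval_colorable G"
  obtains \<alpha> where "w G > 0" "interval_coloring G (w G) \<alpha>"
proof -
  have "\<exists>t. t > 0 \<and> (\<exists>\<alpha>. interval_coloring G t \<alpha>)"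
    using assms by (auto simp: interval_colorable_def)
  from LeastI_ex[OF this] show thesis using that unfolding w_def by blast
qed

lemma W_ge:
  assumes "simple_graph G" "t > 0" "interval_coloring G t \<alpha>"
  shows "t \<le> W G"
  unfolding W_def
proof (rule Greatest_le_nat)
  show "t > 0 \<and> (\<exists>\<alpha>. interval_coloring G t \<alpha>)" using assms(2,3) by blast
  show "s \<le> card (edges G)" if "s > 0 \<and> (\<exists>\<alpha>. interval_coloring G s \<alpha>)" for s
    using that interval_coloring_le_card_edges[OF assms(1)] by blast
qed

lemma W_attained:
  assumes "simple_graph G" "interval_colorable G"
  obtains \<alpha> where "W G > 0" "interval_coloring G (W G) \<alpha>"
proof -
  let ?P = "\<lambda>t. t > 0 \<and> (\<exists>\<alpha>. interval_coloring G t \<alpha>)"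
  have "\<exists>t. ?P t"
    using assms(2) by (auto simp: interval_colorable_def)
  moreover have "s \<le> card (edges G)" if "?P s" for s
    using that interval_coloring_le_card_edges[OF assms(1)] by blast
  ultimately have "?P (W G)"
    unfolding W_def by (rule GreatestI_ex_nat)
  then show thesis using that by blast
qed

section \<open>Arithmetic of blocks of length \<open>m\<close>\<close>

text \<open>Two offsets in one window of length \<open>m\<close> differ by less than
  \<open>m\<close>, whereas the equation makes their difference a multiple of
  \<open>m\<close>.\<close>

lemma block_decomposition_unique:
  fixes a b c d f :: int
  assumes "m * a + c = m * b + d" "c \<in> {f + 1..f + m}" "d \<in> {f + 1..f + m}"
  shows "a = b \<and> c = d"
proof -
  have "(a - b) * m = d - c" using assms(1) by (simp add: algebra_simps)
  moreover have "\<bar>d - c\<bar> < m" using assms by auto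
  ultimately have "\<bar>a - b\<bar> * m < 1 * m" "m > 0" by (auto simp: abs_mult)
  then have "a = b" by (simp add: mult_less_cancel_right)
  then show ?thesis using assms(1) by simp
qed

lemma union_consecutive_blocks:
  fixes a b f m :: int
  assumes "m > 0"
  shows "(\<Union>c\<in>{a..b}. (+) (m * c) ` {f + 1..f + m}) = {m * a + f + 1..m * b + f + m}" (is "?L = ?R")
proof
  show "?L \<subseteq> ?R"
  proof clarify
    fix c y assume "c \<in> {a..b}" "y \<in> {f + 1..f + m}"
    then have "m * a \<le> m * c" "m * c \<le> m * b" "f + 1 \<le> y" "y \<le> f + m"
      using assms by auto
    then show "m * c + y \<in> ?R" unfolding atLeastAtMost_iff by linarith
  qed
next
  show "?R \<subseteq> ?L"
  proof
    fix x assume x: "x \<in> ?R"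
    \<comment> \<open>Subtracting \<open>f + 1\<close> gives remainder 0 to the first color of each
      block, so the quotient is the index of the block containing \<open>x\<close>.\<close>
    define c where "c = (x - f - 1) div m"
    have eq: "x - f - 1 = m * c + (x - f - 1) mod m" by (simp add: c_def)
    have "0 \<le> (x - f - 1) mod m" "(x - f - 1) mod m < m" using assms by auto
    with eq have r: "f + 1 \<le> x - m * c" "x - m * c \<le> f + m" by linarith+
    have "m * a + f + 1 \<le> x" "x \<le> m * b + f + m" using x by simp_all
    with r have "m * a < m * c + m" "m * c < m * b + m" by linarith+
    then have "m * a < m * (c + 1)" "m * c < m * (b + 1)"
      by (simp_all add: distrib_left)
    then have "c \<in> {a..b}" using assms by (simp add: mult_less_cancel_left)
    moreover have "x \<in> (+) (m * c) ` {f + 1..f + m}"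
      by (rule image_eqI[of _ _ "x - m * c"]) (use r in simp_all)
    ultimately show "x \<in> ?L" by blast
  qed
qed

section \<open>Color sets, normalization and spectra\<close>

lemma image_edges_eq_UN_spectrum:
  assumes "simple_graph G"
  shows "\<alpha> ` edges G = (\<Union>v\<in>verts G. spectrum G \<alpha> v)"
proof -
  have "\<exists>v\<in>verts G. v \<in> e" if "e \<in> edges G" for e
  proof -
    have "card e = 2" "e \<subseteq> verts G" using assms that by (auto simp: simple_graph_def)
    then show ?thesis unfolding card_2_iff by auto
  qed
  then show ?thesis unfolding spectrum_def by blast
qed

text \<open>Colors of \<open>G\<close> will serve as block indices. Starting them at 0 leaves the
  copy of \<open>H\<close> unshifted at every vertex that sees the smallest color.\<close>

lemma normalized_interval_coloring:
  assumes "interval_coloring G s \<alpha>"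
  obtains \<beta> where "interval_coloring G s \<beta>" "\<beta> ` edges G = {0..<int s}"
proof -
  obtain c where c: "\<alpha> ` edges G = {c..<c + int s}"
    using assms by (auto simp: interval_coloring_def)
  define \<beta> where "\<beta> e = \<alpha> e - c" for e
  have "\<beta> ` edges G = (\<lambda>x. x - c) ` (\<alpha> ` edges G)"
    by (simp add: \<beta>_def image_image)
  also have "\<dots> = {0..<int s}"
    unfolding c using image_add_atLeastLessThan[of "- c" c "c + int s"] by simp
  finally have img: "\<beta> ` edges G = {0..<int s}" .
  have spec: "spectrum G \<beta> v = (\<lambda>x. x - c) ` spectrum G \<alpha> v" for v
    by (simp add: \<beta>_def spectrum_def image_image)
  have "\<exists>a b. spectrum G \<beta> v = {a..b}" if v: "v \<in> verts G" for v
  proof -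
    obtain a b where "spectrum G \<alpha> v = {a..b}"
      using assms v unfolding interval_coloring_def by blast
    then have "spectrum G \<beta> v = {a - c..b - c}"
      by (simp add: spec)
    then show ?thesis by blast
  qed
  moreover have "proper_coloring G \<beta>"
    using assms by (simp add: interval_coloring_def proper_coloring_def \<beta>_def)
  moreover have "\<exists>c. \<beta> ` edges G = {c..<c + int s}"
    by (rule exI[of _ 0]) (simp add: img)
  ultimately have "interval_coloring G s \<beta>"
    by (simp add: interval_coloring_def)
  then show thesis using img that by blast
qed

text \<open>Isolated vertices fit the same description, with \<open>p = 1\<close> and the default 0,
  since \<open>{1..0}\<close> is empty. The bound on \<open>p\<close> ensures that a window starting
  at \<open>max_color H \<alpha> v + 1\<close> continues the spectrum without a gap.\<close>

lemma spectrum_up_to_max_color: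
  assumes "simple_graph H" "interval_coloring H t \<alpha>" "\<alpha> ` edges H = {1..int t}" "v \<in> verts H"
  obtains p where "1 \<le> p" "p \<le> max_color H \<alpha> v + 1" "spectrum H \<alpha> v = {p..max_color H \<alpha> v}"
    "max_color H \<alpha> v \<le> int t"
proof (cases "spectrum H \<alpha> v = {}")
  case True
  then show thesis by (intro that[of 1]) (simp_all add: max_color_def)
next
  case False
  obtain a b where ab: "spectrum H \<alpha> v = {a..b}"
    using assms(2,4) unfolding interval_coloring_def by blast
  have sub: "spectrum H \<alpha> v \<subseteq> {1..int t}"
    unfolding assms(3)[symmetric] by (auto simp: spectrum_def)
  have max: "max_color H \<alpha> v = b"
  proof -
    have "Max {a..b} = b" by (rule Max_eqI) (use False ab in simp_all)
    then show ?thesis using ab False by (simp add: max_color_def)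
  qed
  have "1 \<le> a" "a \<le> b" "b \<le> int t"
    using sub False by (auto simp: ab)
  then show thesis
    by (intro that[of a]) (simp_all add: ab max)
qed

section \<open>Edges and coloring of the composition\<close>

lemma edges_composition_at:
  assumes "simple_graph G" "simple_graph H" "u \<in> verts G" "v \<in> verts H"
  shows "e \<in> edges (composition G H) \<and> (u, v) \<in> e \<longleftrightarrow>
    (\<exists>v'. {v, v'} \<in> edges H \<and> e = {(u, v), (u, v')}) \<or>
    (\<exists>u' v'. {u, u'} \<in> edges G \<and> v' \<in> verts H \<and> e = {(u, v), (u', v')})" (is "?L \<longleftrightarrow> ?R")
proof
  assume L: ?L
  then obtain u1 v1 u2 v2 where e: "e = {(u1, v1), (u2, v2)}"
    "v1 \<in> verts H" "v2 \<in> verts H" "{u1, u2} \<in> edges G \<or> u1 = u2 \<and> {v1, v2} \<in> edges H"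
    by (auto simp: composition_def)
  from L e(1) consider "u1 = u" "v1 = v" | "u2 = u" "v2 = v" by auto
  then show ?R
  proof cases
    case 1
    with e show ?thesis by blast
  next
    case 2
    with e have "e = {(u, v), (u1, v1)}" "{u, u1} \<in> edges G \<or> u = u1 \<and> {v, v1} \<in> edges H"
      by (auto simp: insert_commute)
    with e show ?thesis by blast
  qed
next
  assume ?R
  moreover have "u' \<in> verts G" if "{u, u'} \<in> edges G" for u'
    using assms(1) that by (auto simp: simple_graph_def)
  moreover have "v' \<in> verts H" if "{v, v'} \<in> edges H" for v'
    using assms(2) that by (auto simp: simple_graph_def)
  ultimately show ?L
    using assms(3,4) unfolding composition_def snd_conv mem_Collect_eq by blast
qed

lemma spectrum_eq_image_neighbours:
  assumes "simple_graph G"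
  shows "spectrum G \<alpha> u = (\<lambda>u'. \<alpha> {u, u'}) ` {u'. {u, u'} \<in> edges G}"
proof -
  have "{e \<in> edges G. u \<in> e} = (\<lambda>u'. {u, u'}) ` {u'. {u, u'} \<in> edges G}"
    using edge_eq_doubleton[OF assms] by blast
  then show ?thesis by (simp add: spectrum_def image_image)
qed

text \<open>The number \<open>s\<close> is arbitrary because both bounds come from this
  construction, with \<open>s = w G\<close> and with \<open>s = W G\<close>.\<close>

lemma composition_interval_coloring:
  assumes G: "simple_graph G" "interval_coloring G s \<alpha>G" "s > 0" "\<alpha>G ` edges G = {0..<int s}"
    and H: "simple_graph H" "interval_coloring H t \<alpha>H" "t > 0" "\<alpha>H ` edges H = {1..int t}"
    and conv: "\<And>x y. x \<in> verts H \<Longrightarrow> y \<in> verts H \<Longrightarrow>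
      {max_color H \<alpha>H x..max_color H \<alpha>H y} \<subseteq> max_color H \<alpha>H ` verts H"
  shows "\<exists>\<beta>. interval_coloring (composition G H) (s * card (verts H) + t) \<beta>"
proof -
  define V where "V = verts H"
  define m where "m = int (card V)"
  define f where "f = max_color H \<alpha>H"
  define SG where "SG = spectrum G \<alpha>G"
  define SH where "SH = spectrum H \<alpha>H"
  define C where "C = composition G H"
  have C: "simple_graph C" "verts C = verts G \<times> V"
    using simple_graph_composition[OF G(1) H(1)] by (simp_all add: C_def composition_def V_def)
  have finV: "finite V" using H(1) by (simp add: V_def simple_graph_def)
  obtain K where K: "\<And>x. x \<in> V \<Longrightarrow> bij_betw (\<lambda>y. K {x, y}) V {f x + 1..f x + m}"
    using complete_bipartite_window_coloring[of V f] conv finV by (auto simp: V_def f_def m_def)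
  \<comment> \<open>At an isolated vertex of \<open>G\<close> the copy of \<open>H\<close> has no
    block to adjoin and keeps its own colors.\<close>
  define d where "d u = (if SG u = {} then 0 else Min (SG u))" for u
  \<comment> \<open>an edge projects to a single vertex of \<open>G\<close> iff it lies in a copy of \<open>H\<close>\<close>
  define \<beta> where "\<beta> e = (if is_singleton (fst ` e) then m * d (the_elem (fst ` e)) + \<alpha>H (snd ` e)
      else m * \<alpha>G (fst ` e) + K (snd ` e))" for e
  have \<beta>_in: "\<beta> {(u, v), (u, v')} = m * d u + \<alpha>H {v, v'}" for u v v'
    by (simp add: \<beta>_def)
  have edge_ne: "u \<noteq> u'" if "{u, u'} \<in> edges G" for u u'
    using G(1) that by (auto simp: simple_graph_def)
  have \<beta>_out: "\<beta> {(u, v), (u', v')} = m * \<alpha>G {u, u'} + K {v, v'}" if "{u, u'} \<in> edges G" for u v u' v'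
    using edge_ne[OF that] by (simp add: \<beta>_def is_singleton_def doubleton_eq_iff)
  have SG: "SG u = (\<lambda>u'. \<alpha>G {u, u'}) ` {u'. {u, u'} \<in> edges G}"
    and SH: "SH v = (\<lambda>v'. \<alpha>H {v, v'}) ` {v'. {v, v'} \<in> edges H}" for u v
    using spectrum_eq_image_neighbours G(1) H(1) by (simp_all add: SG_def SH_def)
  have SG_sub: "SG u \<subseteq> {0..<int s}" for u
    unfolding G(4)[symmetric] SG_def spectrum_def by blast
  have SG_fin: "finite (SG u)" for u
    using SG_sub finite_subset by blast
  have SH_le: "\<exists>p. 1 \<le> p \<and> p \<le> f v + 1 \<and> SH v = {p..f v} \<and> f v \<le> int t" if "v \<in> V" for v
    using spectrum_up_to_max_color[OF H(1,2,4)] that unfolding V_def f_def SH_def by metis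
  have SG_ivl: "\<exists>a b. SG u = {a..b}" if "u \<in> verts G" for u
    using G(2) that by (auto simp: interval_coloring_def SG_def)
  have star: "{e \<in> edges C. (u, v) \<in> e} =
      (\<lambda>v'. {(u, v), (u, v')}) ` {v'. {v, v'} \<in> edges H} \<union>
      (\<lambda>(u', v'). {(u, v), (u', v')}) ` ({u'. {u, u'} \<in> edges G} \<times> V)"
    if "u \<in> verts G" "v \<in> V" for u v
    using edges_composition_at[OF G(1) H(1) that[unfolded V_def]]
    unfolding C_def[symmetric] V_def[symmetric]
    by (simp add: set_eq_iff image_iff) blast

  \<comment> \<open>Every neighbour of \<open>u\<close> contributes a full block, because the row of
    \<open>v\<close> in \<open>K\<close> runs through its whole window.\<close>
  have spec: "spectrum C \<beta> (u, v) = (+) (m * d u) ` SH v \<union> (\<Union>c\<in>SG u. (+) (m * c) ` {f v + 1..f v + m})"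
    if "u \<in> verts G" "v \<in> V" for u v
  proof -
    have "\<beta> ` (\<lambda>v'. {(u, v), (u, v')}) ` {v'. {v, v'} \<in> edges H} = (+) (m * d u) ` SH v"
      by (simp add: image_image \<beta>_in SH)
    moreover have "\<beta> ` (\<lambda>(u', v'). {(u, v), (u', v')}) ` ({u'. {u, u'} \<in> edges G} \<times> V) =
        (\<Union>c\<in>SG u. (+) (m * c) ` {f v + 1..f v + m})"
    proof -
      have "{f v + 1..f v + m} = (\<lambda>y. K {v, y}) ` V"
        using K[OF that(2)] by (simp add: bij_betw_def)
      moreover have "\<beta> ` (\<lambda>(u', v'). {(u, v), (u', v')}) ` ({u'. {u, u'} \<in> edges G} \<times> V) =
          (\<lambda>(u', v'). m * \<alpha>G {u, u'} + K {v, v'}) ` ({u'. {u, u'} \<in> edges G} \<times> V)"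
        unfolding image_image by (intro image_cong) (auto simp: \<beta>_out)
      ultimately show ?thesis by (auto simp: SG)
    qed
    ultimately show ?thesis
      unfolding spectrum_def star[OF that] image_Un by simp
  qed

  \<comment> \<open>Properness is injectivity on each star. Inside the copy of \<open>H\<close> it
    comes from \<open>\<alpha>H\<close>; edges inside have colors at most
    \<open>m * d u + f v\<close>, edges leaving the copy have larger ones; edges leaving it are
    separated by their block, or within a block by \<open>K\<close>.\<close>
  have inj: "inj_on \<beta> {e \<in> edges C. (u, v) \<in> e}" if uv: "u \<in> verts G" "v \<in> V" for u v
  proof -
    have K_mem: "K {v, y} \<in> {f v + 1..f v + m}" if "y \<in> V" for y
      using K[OF uv(2)] that by (auto simp: bij_betw_def)
    have in_out: "m * d u + \<alpha>H {v, v1} < m * \<alpha>G {u, u2} + K {v, v2}"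
      if "{v, v1} \<in> edges H" "{u, u2} \<in> edges G" "v2 \<in> V" for v1 u2 v2
    proof -
      have "\<alpha>G {u, u2} \<in> SG u" using that(2) by (auto simp: SG)
      then have "d u \<le> \<alpha>G {u, u2}" using SG_fin by (auto simp: d_def)
      then have "m * d u \<le> m * \<alpha>G {u, u2}" by (simp add: m_def mult_left_mono)
      moreover have "\<alpha>H {v, v1} \<in> SH v" using that(1) by (auto simp: SH)
      then have "\<alpha>H {v, v1} \<le> f v" using SH_le[OF uv(2)] by auto
      ultimately show ?thesis using K_mem[OF that(3)] unfolding atLeastAtMost_iff by linarith
    qed
    have in_in: "v1 = v2"
      if "{v, v1} \<in> edges H" "{v, v2} \<in> edges H" "\<alpha>H {v, v1} = \<alpha>H {v, v2}" for v1 v2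
      using H(2) that proper_coloring_inj[of H \<alpha>H] by (auto simp: interval_coloring_def)
    have out_out: "u1 = u2 \<and> v1 = v2"
      if "{u, u1} \<in> edges G" "{u, u2} \<in> edges G" "v1 \<in> V" "v2 \<in> V"
        "m * \<alpha>G {u, u1} + K {v, v1} = m * \<alpha>G {u, u2} + K {v, v2}" for u1 u2 v1 v2
    proof -
      have eq: "\<alpha>G {u, u1} = \<alpha>G {u, u2}" "K {v, v1} = K {v, v2}"
        using block_decomposition_unique[OF that(5) K_mem K_mem] that by auto
      have "u1 = u2"
        using G(2) that(1,2) eq(1) proper_coloring_inj[of G \<alpha>G] by (auto simp: interval_coloring_def)
      moreover have "v1 = v2"
        using K[OF uv(2)] eq(2) that(3,4) by (auto simp: bij_betw_def inj_on_def)
      ultimately show ?thesis by simp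
    qed
    show ?thesis
      unfolding star[OF uv]
      by (rule inj_onI, elim UnE imageE SigmaE; clarsimp simp: \<beta>_in \<beta>_out)
        (auto dest: in_in in_out out_out)
  qed

  have proper: "proper_coloring C \<beta>"
    unfolding proper_coloring_def
  proof (intro ballI impI)
    fix e e' assume e: "e \<in> edges C" "e' \<in> edges C" "e \<noteq> e' \<and> e \<inter> e' \<noteq> {}"
    then obtain p where "p \<in> e" "p \<in> e'" by blast
    moreover have "p \<in> verts G \<times> V"
      using C e(1) \<open>p \<in> e\<close> unfolding simple_graph_def by blast
    ultimately have "inj_on \<beta> {e \<in> edges C. p \<in> e}" "e \<in> {e \<in> edges C. p \<in> e}"
      "e' \<in> {e \<in> edges C. p \<in> e}"
      using inj[of "fst p" "snd p"] e(1,2) by (simp_all add: mem_Times_iff)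
    then show "\<beta> e \<noteq> \<beta> e'"
      using e(3) unfolding inj_on_def by blast
  qed

  \<comment> \<open>The bounds on \<open>a\<close> and \<open>b\<close> are carried along to confine
    the set of all colors later.\<close>
  have spec_ivl: "\<exists>a b. spectrum C \<beta> (u, v) = {a..b} \<and> 1 \<le> a \<and> b \<le> m * int s + int t"
    if uv: "u \<in> verts G" "v \<in> V" for u v
  proof -
    have m: "m > 0" using uv(2) finV by (auto simp: m_def card_gt_0_iff)
    obtain p where p: "1 \<le> p" "p \<le> f v + 1" "SH v = {p..f v}" "f v \<le> int t"
      using SH_le[OF uv(2)] by blast
    show ?thesis
    proof (cases "SG u = {}")
      case True
      then have "spectrum C \<beta> (u, v) = {p..f v}"
        by (simp add: spec[OF uv] d_def p(3))
      moreover have "f v \<le> m * int s + int t" using p(4) m by (simp add: add_increasing)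
      ultimately show ?thesis using p(1) by blast
    next
      case False
      obtain a b where ab: "SG u = {a..b}" using SG_ivl[OF uv(1)] by blast
      with False have le_ab: "a \<le> b" by simp
      have "Min {a..b} = a" by (rule Min_eqI) (use le_ab in simp_all)
      with ab False have d: "d u = a" by (simp add: d_def)
      have ab_bd: "0 \<le> a" "b + 1 \<le> int s" using SG_sub[of u] le_ab unfolding ab by auto
      then have bd: "0 \<le> m * a" "m * a \<le> m * b" "m * (b + 1) \<le> m * int s"
        using le_ab m by (simp_all del: of_nat_add)
      have "spectrum C \<beta> (u, v) = {m * a + p..m * a + f v} \<union> {m * a + f v + 1..m * b + f v + m}"
        unfolding spec[OF uv] ab d p(3) union_consecutive_blocks[OF m] by (simp add: add.commute)
      \<comment> \<open>The two intervals adjoin even if the first is empty, as then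
        \<open>p = f v + 1\<close>.\<close>
      also have "\<dots> = {m * a + p..m * b + f v + m}"
      proof -
        have "m * a + f v \<le> m * b + f v + m" using bd m by linarith
        then show ?thesis using p(2) by auto
      qed
      finally have "spectrum C \<beta> (u, v) = {m * a + p..m * b + f v + m}" .
      moreover have "1 \<le> m * a + p" using bd p(1) by linarith
      moreover have "m * b + f v + m \<le> m * int s + int t"
        using bd(3) p(4) unfolding distrib_left by linarith
      ultimately show ?thesis by blast
    qed
  qed

  have img: "\<beta> ` edges C = {1..m * int s + int t}"
  proof
    show "\<beta> ` edges C \<subseteq> {1..m * int s + int t}"
      unfolding image_edges_eq_UN_spectrum[OF C(1)] C(2)
    proof clarify
      fix x u v assume "u \<in> verts G" "v \<in> V" "x \<in> spectrum C \<beta> (u, v)"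
      then show "x \<in> {1..m * int s + int t}" using spec_ivl[of u v] by fastforce
    qed
  next
    have G_at: "\<exists>u\<in>verts G. c \<in> SG u" if "c \<in> {0..<int s}" for c
      using that image_edges_eq_UN_spectrum[OF G(1), of \<alpha>G] by (auto simp: G(4) SG_def)
    have H_at: "\<exists>v\<in>V. c \<in> SH v" if "c \<in> {1..int t}" for c
      using that image_edges_eq_UN_spectrum[OF H(1), of \<alpha>H] by (auto simp: H(4) SH_def V_def)
    show "{1..m * int s + int t} \<subseteq> \<beta> ` edges C"
    proof
      fix x assume x: "x \<in> {1..m * int s + int t}"
      have "\<exists>u\<in>verts G. \<exists>v\<in>V. x \<in> spectrum C \<beta> (u, v)"
      \<comment> \<open>Colors up to \<open>t\<close> occur in the copy of \<open>H\<close> at a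
        vertex with color 0 in \<open>G\<close>, where the shift is 0. The others occur above a
        vertex \<open>v\<close> with \<open>f v = int t\<close>: its blocks for
        \<open>c = 0, ..., s - 1\<close> tile the colors from \<open>t + 1\<close> to
        \<open>s * m + t\<close>.\<close>
      proof (cases "x \<le> int t")
        case True
        then obtain v where v: "v \<in> V" "x \<in> SH v" using H_at[of x] x by auto
        obtain u where u: "u \<in> verts G" "0 \<in> SG u" using G_at[of 0] G(3) by auto
        have "Min (SG u) = 0"
          by (rule Min_eqI) (use SG_sub[of u] SG_fin u(2) in auto)
        then have "d u = 0" by (simp add: d_def)
        then have "x \<in> spectrum C \<beta> (u, v)" using v by (simp add: spec[OF u(1) v(1)])
        then show ?thesis using u v by blast
      next
        case False
        obtain v where v: "v \<in> V" "int t \<in> SH v" using H_at[of "int t"] H(3) by auto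
        then have fv: "f v = int t" using SH_le[OF v(1)] by auto
        have m: "m > 0" using v(1) finV by (auto simp: m_def card_gt_0_iff)
        have "x \<in> {m * 0 + int t + 1..m * (int s - 1) + int t + m}"
          using x False by (simp add: right_diff_distrib)
        then obtain c where c: "c \<in> {0..int s - 1}" "x \<in> (+) (m * c) ` {int t + 1..int t + m}"
          unfolding union_consecutive_blocks[OF m, symmetric] by blast
        obtain u where u: "u \<in> verts G" "c \<in> SG u" using G_at[of c] c(1) by auto
        then have "x \<in> spectrum C \<beta> (u, v)"
          using c(2) unfolding spec[OF u(1) v(1)] fv by blast
        then show ?thesis using u v by blast
      qed
      then show "x \<in> \<beta> ` edges C"
        unfolding image_edges_eq_UN_spectrum[OF C(1)] C(2) by blast
    qed
  qed

  have "\<exists>c. \<beta> ` edges C = {c..<c + int (s * card V + t)}"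
    by (rule exI[of _ 1]) (auto simp: img m_def mult.commute)
  moreover have "\<forall>p\<in>verts C. \<exists>a b. spectrum C \<beta> p = {a..b}"
    using spec_ivl unfolding C(2) by fast
  ultimately show ?thesis
    using proper unfolding interval_coloring_def C_def V_def by blast
qed

section \<open>The bounds on \<open>w\<close> and \<open>W\<close>\<close>

theorem theorem4:
  fixes G :: "'a ugraph" and H :: "'b ugraph"
    and n t :: nat and \<alpha>H :: "'b set \<Rightarrow> int" and L :: "int list"
  assumes "simple_graph G" and "interval_colorable G"
    and "simple_graph H" and "card (verts H) = n"
    and "t > 0" and "interval_coloring H t \<alpha>H" and "Min (\<alpha>H ` edges H) = 1"
    and "L = USE H (verts H) \<alpha>H" and "continuous_seq L"
  shows "interval_colorable (composition G H) \<and>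
    int (w (composition G H)) \<le> int (w G * n) + Max (set L) \<and>
    int (W (composition G H)) \<ge> int (W G * n) + Max (set L)"
proof -
  let ?f = "max_color H \<alpha>H"
  obtain c where c: "\<alpha>H ` edges H = {c..<c + int t}"
    using assms(6) by (auto simp: interval_coloring_def)
  \<comment> \<open>\<open>USE\<close> depends on where the colors of \<open>\<alpha>H\<close>
    start; the normalization to smallest color 1 makes the largest color equal to
    \<open>t\<close>.\<close>
  have "Min {c..<c + int t} = c"
    by (rule Min_eqI) (use assms(5) in auto)
  with assms(7) c have colors: "\<alpha>H ` edges H = {1..int t}" by auto
  have fin: "finite (verts H)" using assms(3) by (simp add: simple_graph_def)
  have set_L: "set L = ?f ` verts H"
    using fin by (simp add: assms(8) USE_def)
  have conv: "{?f x..?f y} \<subseteq> ?f ` verts H" if "x \<in> verts H" "y \<in> verts H" for x y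
  proof
    fix k assume k: "k \<in> {?f x..?f y}"
    have "Min (set L) \<le> ?f x" "?f y \<le> Max (set L)"
      using that fin by (simp_all add: set_L)
    with k have "Min (set L) \<le> k \<and> k \<le> Max (set L)" by auto
    then show "k \<in> ?f ` verts H"
      using assms(9) unfolding continuous_seq_def set_L by blast
  qed
  have le_t: "?f v \<le> int t" if "v \<in> verts H" for v
    using spectrum_up_to_max_color[OF assms(3,6) colors that] by blast
  \<comment> \<open>An end of an edge of color \<open>t\<close> has largest color \<open>t\<close>,
    which identifies the maximum of \<open>L\<close> with the number of colors.\<close>
  have "int t \<in> \<alpha>H ` edges H" using colors assms(5) by auto
  then obtain v where v: "v \<in> verts H" "int t \<in> spectrum H \<alpha>H v"
    unfolding image_edges_eq_UN_spectrum[OF assms(3)] by blast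
  then have "int t \<le> ?f v"
    using finite_spectrum[OF assms(3)] by (auto simp: max_color_def)
  with le_t[OF v(1)] have "?f v = int t" by simp
  then have Max_L: "Max (set L) = int t"
    using le_t v(1) fin unfolding set_L by (intro Max_eqI) (auto intro: rev_image_eqI)
  have main: "\<exists>\<beta>. interval_coloring (composition G H) (s * n + t) \<beta>"
    if "s > 0" "interval_coloring G s \<alpha>" for s \<alpha>
  proof -
    obtain \<alpha>' where "interval_coloring G s \<alpha>'" "\<alpha>' ` edges G = {0..<int s}"
      using normalized_interval_coloring[OF \<open>interval_coloring G s \<alpha>\<close>] .
    from composition_interval_coloring[OF assms(1) this(1) that(1) this(2) assms(3,6,5) colors conv]
    show ?thesis using assms(4) by simp
  qed
  obtain \<alpha>w where "w G > 0" "interval_coloring G (w G) \<alpha>w"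
    using w_attained[OF assms(2)] .
  from main[OF this] obtain \<beta>w where \<beta>w: "interval_coloring (composition G H) (w G * n + t) \<beta>w" ..
  obtain \<alpha>W where "W G > 0" "interval_coloring G (W G) \<alpha>W"
    using W_attained[OF assms(1,2)] .
  from main[OF this] obtain \<beta>W where \<beta>W: "interval_coloring (composition G H) (W G * n + t) \<beta>W" ..
  have "w (composition G H) \<le> w G * n + t"
    using w_le[OF _ \<beta>w] assms(5) by simp
  moreover have "W G * n + t \<le> W (composition G H)"
    using W_ge[OF simple_graph_composition[OF assms(1,3)] _ \<beta>W] assms(5) by simp
  moreover have "interval_colorable (composition G H)"
    using \<beta>w assms(5) unfolding interval_colorable_def by (metis add_gr_0)
  ultimately show ?thesis
    unfolding Max_L by (simp flip: of_nat_add of_nat_mult)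
qed

end
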